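(* Let $\bm{x}_1,\dots,\bm{x}_n\in\mathbb{R}^p$, $y_1,\dots,y_n\in\{-1,1\}$ and $\lambda>0$. The max/min problem $$\max_{\substack{\bm{\gamma}\in\mathbb{R}_+^n:\\ \bm{I}-\sum_{i=1}^n\gamma_i\bm{x}_i\bm{x}_i^\top\succeq 0}}\ \min_{\substack{\bm{w}\in\mathbb{R}^p\\ \bm{z}\in[0,1]^n}}\ \|\bm{w}\|_2^2+\lambda\sum_{i=1}^n z_i-\sum_{i=1}^n\gamma_i\big(1-y_i\bm{x}_i^\top\bm{w}\big)^2+\sum_{i=1}^n\gamma_i\left(\frac{(1-y_i\bm{x}_i^\top\bm{w})_+^2}{z_i}+\frac{(1-y_i\bm{x}_i^\top\bm{w})_-^2}{1-z_i}\right)$$ is equivalent to (that is, has the same optimal value as) the semidefinite program $$\begin{aligned}\min_{\bm{w},\bm{z},\bm{W}}\quad & \operatorname{Tr}(\bm{W})+\lambda\sum_{i=1}^n z_i\\ \text{s.t.}\quad & \langle\bm{x}_i\bm{x}_i^\top,\bm{W}\rangle-2y_i(\bm{x}_i^\top\bm{w})+1\geq\frac{(1-y_i(\bm{x}_i^\top\bm{w}))_+^2}{z_i}+\frac{(1-y_i(\bm{x}_i^\top\bm{w}))_-^2}{1-z_i},\quad i=1,\dots,n,\\ & \begin{pmatrix}1&\bm{w}^\top\\ \bm{w}&\bm{W}\end{pmatrix}\succeq 0,\quad \bm{w}\in\mathbb{R}^p,\ \bm{W}\in\mathbb{R}^{p\times p},\quad \bm{z}\in[0,1]^n.\end{ali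gned}$$
   Context: For $\alpha\in\mathbb{R}$, $(\alpha)_+:=\max\{\alpha,0\}$ and $(\alpha)_-:=\max\{-\alpha,0\}$, and $(\alpha)_\pm^2:=((\alpha)_\pm)^2$. Convention for division by $0$: for $a\in\mathbb{R}$, $a^2/0=0$ if $a=0$ and $a^2/0=+\infty$ otherwise; a term with coefficient $\gamma_i=0$ is taken to be $0$. $\bm{A}\succeq 0$ means that $\bm{A}$ is symmetric positive semidefinite, $\bm{I}$ is the $p\times p$ identity matrix, and $\langle\bm{A},\bm{B}\rangle:=\sum_i\sum_j A_{ij}B_{ij}$. Optimal values are understood as suprema/infima. *)

theory Defs
  imports "HOL-Analysis.Analysis"
begin

definition pos_part :: "real \<Rightarrow> real"
  where "pos_part a = max a 0"

definition neg_part :: "real \<Rightarrow> real"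
  where "neg_part a = max (- a) 0"

definition psd :: "real ^ 'k ^ 'k \<Rightarrow> bool"
  where "psd A \<longleftrightarrow> transpose A = A \<and> (\<forall>v. v \<bullet> (A *v v) \<ge> 0)"

definition outer :: "real ^ 'p \<Rightarrow> real ^ 'p ^ 'p"
  where "outer v = (\<chi> i j. v $ i * v $ j)"

text \<open>The inner product of \<open>real ^ 'p ^ 'p\<close> is the Frobenius inner product.\<close>

lemma matrix_inner_eq:
  fixes A B :: "real ^ 'p ^ 'p"
  shows "A \<bullet> B = (\<Sum>i\<in>UNIV. \<Sum>j\<in>UNIV. A $ i $ j * B $ i $ j)"
  by (simp add: inner_vec_def)

text \<open>
  The block matrix with first row \<open>(1, w)\<close> and remaining rows \<open>(w, W)\<close>. The index type
  \<open>'p option\<close> has one element more than \<open>'p\<close>: \<open>None\<close> is the first row or column, and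
  \<open>Some i\<close> is the one belonging to \<open>i\<close>.
\<close>

definition block :: "real ^ 'p \<Rightarrow> real ^ 'p ^ 'p \<Rightarrow> real ^ 'p option ^ 'p option"
  where "block w W = (\<chi> a b.
    (case a of
       None \<Rightarrow> (case b of None \<Rightarrow> 1 | Some j \<Rightarrow> w $ j)
     | Some i \<Rightarrow> (case b of None \<Rightarrow> w $ i | Some j \<Rightarrow> W $ i $ j)))"

text \<open>
  Division and multiplication in \<open>ereal\<close> have the required conventions: \<open>a\<^sup>2 / 0\<close> is \<open>0\<close>
  for \<open>a = 0\<close> and \<open>\<infinity>\<close> otherwise, and \<open>0 * \<infinity> = 0\<close>.
\<close>

lemma ereal_square_divide_zero:
  "ereal (a\<^sup>2) / ereal 0 = (if a = 0 then 0 else \<infinity>)"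
  by (simp add: divide_ereal_def zero_ereal_def[symmetric])

definition split_cost :: "real \<Rightarrow> real \<Rightarrow> ereal"
  where "split_cost r z =
    ereal ((pos_part r)\<^sup>2) / ereal z + ereal ((neg_part r)\<^sup>2) / ereal (1 - z)"

definition unit_box :: "(real ^ 'n) set"
  where "unit_box = {z. \<forall>i. 0 \<le> z $ i \<and> z $ i \<le> 1}"

definition dual_feasible :: "('n::finite \<Rightarrow> real ^ 'p) \<Rightarrow> (real ^ 'n) set"
  where "dual_feasible x =
    {\<gamma>. (\<forall>i. 0 \<le> \<gamma> $ i) \<and> psd (mat 1 - (\<Sum>i\<in>UNIV. \<gamma> $ i *\<^sub>R outer (x i)))}"

definition saddle_objective ::
  "('n::finite \<Rightarrow> real ^ 'p) \<Rightarrow> ('n \<Rightarrow> real) \<Rightarrow> real \<Rightarrow> real ^ 'n \<Rightarrow> real ^ 'p \<Rightarrow> real ^ 'n \<Rightarrow> ereal"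
  where "saddle_objective x y lam \<gamma> w z =
    ereal ((norm w)\<^sup>2 + lam * (\<Sum>i\<in>UNIV. z $ i)
      - (\<Sum>i\<in>UNIV. \<gamma> $ i * (1 - y i * (x i \<bullet> w))\<^sup>2))
    + (\<Sum>i\<in>UNIV. ereal (\<gamma> $ i) * split_cost (1 - y i * (x i \<bullet> w)) (z $ i))"

definition sdp_feasible ::
  "('n::finite \<Rightarrow> real ^ 'p) \<Rightarrow> ('n \<Rightarrow> real) \<Rightarrow> ((real ^ 'p) \<times> (real ^ 'n) \<times> (real ^ 'p ^ 'p)) set"
  where "sdp_feasible x y =
    {(w, z, W).
       (\<forall>i. ereal (outer (x i) \<bullet> W - 2 * y i * (x i \<bullet> w) + 1)
              \<ge> split_cost (1 - y i * (x i \<bullet> w)) (z $ i))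
       \<and> psd (block w W) \<and> z \<in> unit_box}"

end

theory Submission
  imports Defs
begin

text \<open>
  Writing \<open>W = w w\<^sup>T + P\<close> with \<open>P \<succeq> 0\<close>, the Lagrangian of the semidefinite program with multipliers
  \<open>\<gamma>\<close> for the scalar constraints is the saddle objective plus \<open>\<langle>I - \<Sum>\<^sub>i \<gamma>\<^sub>i x\<^sub>i x\<^sub>i\<^sup>T, P\<rangle>\<close>, whose infimum
  over \<open>P\<close> is \<open>0\<close> or \<open>-\<infinity>\<close> according to whether \<open>\<gamma>\<close> is dual feasible. So the theorem is Lagrangian
  duality. Weak duality is the nonnegativity of the inner product of two positive semidefinite
  matrices. For strong duality, the convex set of achievable pairs (perturbation, objective) is
  separated from the optimal value; the hyperplane is not vertical by Slater's condition, which
  holds for every constraint with \<open>x\<^sub>i \<noteq> 0\<close> because \<open>W\<close> can be enlarged. If \<open>x\<^sub>i = 0\<close>, the constraint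
  forces \<open>z\<^sub>i = 1\<close>, and the multiplier \<open>\<gamma>\<^sub>i = \<lambda>\<close> attains the same value, since
  \<open>\<lambda> z + \<lambda> (1 / z - 1) \<ge> \<lambda>\<close>.
\<close>

section \<open>Positive semidefinite matrices\<close>

lemma outer_mult_vec: "outer a *v v = (a \<bullet> v) *\<^sub>R a"
  by (simp add: vec_eq_iff outer_def matrix_vector_mult_def inner_vec_def sum_distrib_left mult_ac)

lemma outer_0: "outer 0 = 0"
  by (simp add: outer_def vec_eq_iff)

lemma outer_inner: "outer a \<bullet> W = a \<bullet> (W *v a)"
  by (simp add: outer_def matrix_vector_mult_def inner_vec_def sum_distrib_left mult_ac)

lemma outer_inner_outer: "outer a \<bullet> outer b = (a \<bullet> b)\<^sup>2"
  by (simp add: outer_inner outer_mult_vec power2_eq_square inner_commute)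

lemma mat_1_inner: "mat 1 \<bullet> A = trace A"
proof -
  have "(\<Sum>j\<in>UNIV. (if i = j then 1 else 0) * A $ i $ j) = A $ i $ i" for i
    by (simp add: if_distrib[of "\<lambda>c. c * _"] cong: if_cong)
  then show ?thesis
    by (simp add: matrix_inner_eq mat_def trace_def)
qed

lemma trace_scaleR: "trace (c *\<^sub>R A) = c * trace A" for A :: "real ^ 'n ^ 'n"
  by (simp add: trace_def sum_distrib_left)

lemma transpose_outer: "transpose (outer a) = outer a"
  by (simp add: vec_eq_iff outer_def transpose_def)

lemma trace_outer: "trace (outer a) = (norm a)\<^sup>2"
  by (simp add: trace_def outer_def power2_norm_eq_inner inner_vec_def)

lemma matrix_vector_mult_sum: "(\<Sum>i\<in>S. A i) *v v = (\<Sum>i\<in>S. A i *v v)"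
  for A :: "'i \<Rightarrow> real ^ 'n ^ 'm"
  by (induction S rule: infinite_finite_induct)
    (simp_all add: matrix_vector_mult_add_rdistrib)

lemma psd_outer: "psd (outer a)"
  by (simp add: psd_def transpose_outer outer_mult_vec inner_commute)

text \<open>Cauchy-Schwarz for the semidefinite form of \<open>M\<close>, applied to the
  \<open>k\<close>-th basis vector and \<open>v\<close>: the quadratic in \<open>c\<close> given by
  the form at \<open>v - c *\<^sub>R e\<close> is nonnegative, so its discriminant is not
  positive.\<close>

lemma psd_row_Cauchy_Schwarz:
  assumes "psd M"
  shows "(M $ k \<bullet> v)\<^sup>2 \<le> M $ k $ k * (v \<bullet> (M *v v))"
proof -
  define e :: "real ^ 'a" where "e = axis k 1"
  have sym: "transpose M = M" and pos: "\<And>v. 0 \<le> v \<bullet> (M *v v)"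
    using assms by (auto simp: psd_def)
  have rv: "e \<bullet> (M *v v) = M $ k \<bullet> v" for v
    by (simp add: e_def inner_axis' matrix_vector_mul_component)
  have vr: "v \<bullet> (M *v e) = M $ k \<bullet> v" for v
    by (metis dot_lmul_matrix inner_commute rv sym vector_transpose_matrix)
  have ee: "M $ k \<bullet> e = M $ k $ k"
    by (simp add: e_def inner_axis)
  define q b d where "q = v \<bullet> (M *v v)" and "b = M $ k \<bullet> v" and "d = M $ k $ k"
  have quad: "0 \<le> q - 2 * c * b + c\<^sup>2 * d" for c
    using pos[of "v - c *\<^sub>R e"]
    by (simp add: matrix_vector_mult_diff_distrib matrix_vector_mult_scaleR inner_diff_left
        inner_diff_right rv vr ee q_def b_def d_def power2_eq_square algebra_simps)
  have "0 \<le> d" using pos[of e] by (simp add: rv ee d_def)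
  have "b\<^sup>2 \<le> d * q"
  proof (cases "d = 0")
    case True
    have "b = 0"
    proof (rule ccontr)
      assume "b \<noteq> 0"
      \<comment> \<open>With \<open>d = 0\<close> the quadratic is affine in \<open>c\<close>, and
        this \<open>c\<close> makes it equal to \<open>-1\<close>.\<close>
      then show False using quad[of "(q + 1) / (2 * b)"] True by simp
    qed
    then show ?thesis using True by simp
  next
    case False
    then have "0 < d" using \<open>0 \<le> d\<close> by simp
    \<comment> \<open>The minimiser of the quadratic is \<open>c = b / d\<close>.\<close>
    have "q - 2 * (b / d) * b + (b / d)\<^sup>2 * d = q - b\<^sup>2 / d"
      using \<open>0 < d\<close> by (simp add: power2_eq_square field_simps)
    then have "b\<^sup>2 / d \<le> q" using quad[of "b / d"] by simp
    then show ?thesis using \<open>0 < d\<close> by (simp add: pos_divide_le_eq mult.commute)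
  qed
  then show ?thesis by (simp add: q_def b_def d_def)
qed

text \<open>Peel rank-one terms off \<open>M\<close> as in a Cholesky decomposition; \<open>K\<close> contains the support.\<close>

lemma psd_inner_nonneg:
  assumes "psd M" "psd P"
  shows "0 \<le> M \<bullet> P"
proof -
  have "psd M \<Longrightarrow> \<forall>i. i \<notin> K \<longrightarrow> M $ i = 0 \<Longrightarrow> 0 \<le> M \<bullet> P" if "finite K" for K
    using that
  proof (induction K arbitrary: M rule: finite_induct)
    case empty
    then have "M = 0" by (simp add: vec_eq_iff)
    then show ?case by simp
  next
    case (insert k K)
    note CS = psd_row_Cauchy_Schwarz[OF insert.prems(1), of k]
    have sym: "transpose M = M" and pos: "\<And>v. 0 \<le> v \<bullet> (M *v v)"
      using insert.prems(1) by (auto simp: psd_def)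
    have symk: "M $ i $ k = M $ k $ i" for i
      using sym by (metis transpose_def vec_lambda_beta)
    show ?case
    proof (cases "M $ k $ k = 0")
      case True
      \<comment> \<open>A zero diagonal entry kills its row: for \<open>v = M $ k\<close> the
        inequality bounds the fourth power of the norm of the row by 0.\<close>
      then have "M $ k = 0" using CS[of "M $ k"] by simp
      then have "\<forall>i. i \<notin> K \<longrightarrow> M $ i = 0" using insert.prems(2) by auto
      then show ?thesis using insert.IH insert.prems(1) by blast
    next
      case False
      have "0 \<le> M $ k $ k"
        using pos[of "axis k 1"] by (simp add: inner_axis' matrix_vector_mul_component inner_axis)
      then have d: "0 < M $ k $ k" using False by simp
      \<comment> \<open>One elimination step: row \<open>k\<close> of \<open>N\<close> vanishes, so
        the support shrinks to \<open>K\<close>, and the row inequality is exactly what keeps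
        \<open>N\<close> positive semidefinite.\<close>
      define N where "N = M - (1 / M $ k $ k) *\<^sub>R outer (M $ k)"
      have "v \<bullet> (N *v v) = v \<bullet> (M *v v) - (M $ k \<bullet> v)\<^sup>2 / M $ k $ k" for v
        by (simp add: N_def matrix_vector_mult_diff_rdistrib scaleR_matrix_vector_assoc[symmetric]
            outer_mult_vec inner_diff_right power2_eq_square inner_commute)
      moreover have "(M $ k \<bullet> v)\<^sup>2 / M $ k $ k \<le> v \<bullet> (M *v v)" for v
        using CS[of v] d by (simp add: pos_divide_le_eq mult.commute)
      moreover have "transpose N = N"
        using sym transpose_outer[of "M $ k"] unfolding N_def transpose_def vec_eq_iff by simp
      ultimately have "psd N" by (simp add: psd_def)
      moreover have "N $ i = 0" if "i \<notin> K" for i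
      proof (cases "i = k")
        case True
        then show ?thesis using d by (simp add: N_def outer_def vec_eq_iff)
      next
        case False
        then have "M $ i = 0" using insert.prems(2) that by simp
        \<comment> \<open>By symmetry the subtracted rank-one term has a zero row \<open>i\<close>
          as well, so no row outside \<open>K\<close> is filled in.\<close>
        moreover from this have "M $ k $ i = 0" using symk[of i] by simp
        ultimately show ?thesis by (simp add: N_def outer_def vec_eq_iff)
      qed
      ultimately have "0 \<le> N \<bullet> P" using insert.IH by blast
      moreover have "0 \<le> outer (M $ k) \<bullet> P" using assms(2) by (simp add: outer_inner psd_def)
      moreover have "M = N + (1 / M $ k $ k) *\<^sub>R outer (M $ k)" by (simp add: N_def)
      then have "M \<bullet> P = N \<bullet> P + (1 / M $ k $ k) * (outer (M $ k) \<bullet> P)"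
        by (metis inner_add_left inner_scaleR_left)
      ultimately show ?thesis using d by simp
    qed
  qed
  from this[of UNIV] assms(1) show ?thesis by simp
qed

section \<open>The Schur complement of the block matrix\<close>

lemma sum_UNIV_option: "(\<Sum>a\<in>UNIV. f a) = f None + (\<Sum>i\<in>UNIV. f (Some i))"
  for f :: "'a::finite option \<Rightarrow> 'b::comm_monoid_add"
  by (simp add: UNIV_option_conv sum.reindex)

lemma block_quadratic_form:
  fixes w :: "real ^ 'k::finite" and v :: "real ^ 'k option"
  defines "u \<equiv> (\<chi> i. v $ Some i)"
  shows "v \<bullet> (block w W *v v) = (v $ None)\<^sup>2 + 2 * v $ None * (w \<bullet> u) + u \<bullet> (W *v u)"
  by (simp add: u_def inner_vec_def matrix_vector_mult_def sum_UNIV_option block_def power2_eq_square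
      sum.distrib sum_distrib_left algebra_simps)

text \<open>Completing the square: at a vector with first entry \<open>t\<close> and remaining
  entries \<open>u\<close>, the block form is \<open>(t + w \<bullet> u)\<^sup>2 + u \<bullet> ((W -
  outer w) *v u)\<close>.\<close>

lemma psd_block_iff: "psd (block w W) \<longleftrightarrow> psd (W - outer w)"
proof -
  have sym: "transpose (block w W) = block w W \<longleftrightarrow> transpose (W - outer w) = W - outer w"
    by (auto simp: vec_eq_iff transpose_def block_def outer_def mult.commute
        split: option.splits)
  have form: "u \<bullet> ((W - outer w) *v u) = u \<bullet> (W *v u) - (w \<bullet> u)\<^sup>2" for u
    by (simp add: matrix_vector_mult_diff_rdistrib outer_mult_vec inner_diff_right
        power2_eq_square inner_commute)
  have "(\<forall>v. 0 \<le> v \<bullet> (block w W *v v)) \<longleftrightarrow> (\<forall>u. (w \<bullet> u)\<^sup>2 \<le> u \<bullet> (W *v u))"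
  proof (intro iffI allI)
    fix u assume *: "\<forall>v. 0 \<le> v \<bullet> (block w W *v v)"
    \<comment> \<open>The first entry is chosen to make the completed square vanish.\<close>
    define v :: "real ^ 'a option"
      where "v = (\<chi> a. case a of None \<Rightarrow> - (w \<bullet> u) | Some i \<Rightarrow> u $ i)"
    have "0 \<le> v \<bullet> (block w W *v v)" using * by blast
    also have "\<dots> = u \<bullet> (W *v u) - (w \<bullet> u)\<^sup>2"
      by (simp add: block_quadratic_form v_def power2_eq_square)
    finally show "(w \<bullet> u)\<^sup>2 \<le> u \<bullet> (W *v u)" by simp
  next
    fix v :: "real ^ 'a option" assume *: "\<forall>u. (w \<bullet> u)\<^sup>2 \<le> u \<bullet> (W *v u)"
    define u where "u = (\<chi> i. v $ Some i)"
    have "0 \<le> (v $ None + w \<bullet> u)\<^sup>2" by simp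
    also have "\<dots> \<le> (v $ None)\<^sup>2 + 2 * v $ None * (w \<bullet> u) + u \<bullet> (W *v u)"
      using *[rule_format, of u] by (simp add: power2_sum)
    finally show "0 \<le> v \<bullet> (block w W *v v)" by (simp add: block_quadratic_form u_def)
  qed
  then show ?thesis unfolding psd_def sym form by simp
qed

lemma psd_block_outer: "psd (block w (outer w))"
  unfolding psd_block_iff by (simp add: psd_def vec_eq_iff transpose_def)

text \<open>The corner entry 1 is preserved because \<open>s + t = 1\<close>, so the block of a
  convex combination is the convex combination of the blocks.\<close>

lemma psd_block_convex:
  assumes p: "psd (block w1 W1)" "psd (block w2 W2)" and st: "0 \<le> s" "0 \<le> t" "s + t = 1"
  shows "psd (block (s *\<^sub>R w1 + t *\<^sub>R w2) (s *\<^sub>R W1 + t *\<^sub>R W2))"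
proof -
  have eq: "block (s *\<^sub>R w1 + t *\<^sub>R w2) (s *\<^sub>R W1 + t *\<^sub>R W2)
      = s *\<^sub>R block w1 W1 + t *\<^sub>R block w2 W2"
    using st(3) by (simp add: vec_eq_iff block_def split: option.splits)
  show ?thesis
    using p st unfolding eq psd_def
    by (simp add: vec_eq_iff transpose_def matrix_vector_mult_add_rdistrib
        scaleR_matrix_vector_assoc[symmetric] inner_add_right)
qed

section \<open>The split cost\<close>

text \<open>A division-free form that also holds at \<open>z = 0\<close>: there it reads
  \<open>c = 0\<close> and \<open>0 \<le> a\<close>, which is the convention for division by
  zero.\<close>

lemma ereal_divide_le_iff:
  assumes "0 \<le> c" "0 \<le> z"
  shows "ereal c / ereal z \<le> ereal a \<longleftrightarrow> 0 \<le> a \<and> c \<le> a * z"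
proof (cases "z = 0")
  case True
  then show ?thesis using assms
    by (cases "c = 0") (auto simp: divide_ereal_def zero_ereal_def[symmetric])
next
  case False
  then have "0 < z" using assms by simp
  have "0 \<le> a" if "c \<le> a * z" using that assms \<open>0 < z\<close>
    by (metis order_trans zero_le_mult_iff linorder_not_less)
  then show ?thesis using \<open>0 < z\<close> by (auto simp: pos_divide_le_eq)
qed

text \<open>Describes the epigraph by two rotated quadratic cones, with \<alpha> and \<beta>
  bounding the two quotients. This leaves only real inequalities and treats the ends of the unit
  interval uniformly.\<close>

lemma split_cost_le_iff:
  assumes "0 \<le> z" "z \<le> 1"
  shows "split_cost r z \<le> ereal b \<longleftrightarrow>
    (\<exists>\<alpha> \<beta>. 0 \<le> \<alpha> \<and> 0 \<le> \<beta> \<and> (pos_part r)\<^sup>2 \<le> \<alpha> * z \<and> (neg_part r)\<^sup>2 \<le> \<beta> * (1 - z) \<and> \<alpha> + \<beta> \<le> b)"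
proof -
  have P: "ereal ((pos_part r)\<^sup>2) / ereal z \<le> ereal \<alpha> \<longleftrightarrow> 0 \<le> \<alpha> \<and> (pos_part r)\<^sup>2 \<le> \<alpha> * z" for \<alpha>
    using assms by (intro ereal_divide_le_iff) auto
  have N: "ereal ((neg_part r)\<^sup>2) / ereal (1 - z) \<le> ereal \<beta> \<longleftrightarrow> 0 \<le> \<beta> \<and> (neg_part r)\<^sup>2 \<le> \<beta> * (1 - z)" for \<beta>
    using assms by (intro ereal_divide_le_iff) auto
  have pos: "0 \<le> ereal ((pos_part r)\<^sup>2) / ereal z" "0 \<le> ereal ((neg_part r)\<^sup>2) / ereal (1 - z)"
    using assms by (simp_all add: zero_le_divide_ereal)
  have "split_cost r z \<le> ereal b \<longleftrightarrow> (\<exists>\<alpha> \<beta>. ereal ((pos_part r)\<^sup>2) / ereal z \<le> ereal \<alpha>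
      \<and> ereal ((neg_part r)\<^sup>2) / ereal (1 - z) \<le> ereal \<beta> \<and> \<alpha> + \<beta> \<le> b)"
  proof
    assume "split_cost r z \<le> ereal b"
    then show "\<exists>\<alpha> \<beta>. ereal ((pos_part r)\<^sup>2) / ereal z \<le> ereal \<alpha>
      \<and> ereal ((neg_part r)\<^sup>2) / ereal (1 - z) \<le> ereal \<beta> \<and> \<alpha> + \<beta> \<le> b"
      unfolding split_cost_def using pos
      by (cases "ereal ((pos_part r)\<^sup>2) / ereal z"; cases "ereal ((neg_part r)\<^sup>2) / ereal (1 - z)") auto
  next
    assume "\<exists>\<alpha> \<beta>. ereal ((pos_part r)\<^sup>2) / ereal z \<le> ereal \<alpha>
      \<and> ereal ((neg_part r)\<^sup>2) / ereal (1 - z) \<le> ereal \<beta> \<and> \<alpha> + \<beta> \<le> b"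
    then obtain \<alpha> \<beta> where "ereal ((pos_part r)\<^sup>2) / ereal z \<le> ereal \<alpha>"
      "ereal ((neg_part r)\<^sup>2) / ereal (1 - z) \<le> ereal \<beta>" and le: "\<alpha> + \<beta> \<le> b" by blast
    then have "split_cost r z \<le> ereal \<alpha> + ereal \<beta>" unfolding split_cost_def by (intro add_mono)
    also have "\<dots> \<le> ereal b" using le by simp
    finally show "split_cost r z \<le> ereal b" .
  qed
  then show ?thesis unfolding P N by blast
qed

lemma split_cost_nonneg:
  assumes "0 \<le> z" "z \<le> 1"
  shows "0 \<le> split_cost r z"
  unfolding split_cost_def using assms by (simp add: zero_le_divide_ereal)

lemma split_cost_interior:
  assumes "0 < z" "z < 1"
  shows "split_cost r z = ereal ((pos_part r)\<^sup>2 / z + (neg_part r)\<^sup>2 / (1 - z))"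
  using assms by (simp add: split_cost_def)

lemma split_cost_one_one: "split_cost 1 1 = ereal 1"
  by (simp add: split_cost_def pos_part_def neg_part_def divide_ereal_def zero_ereal_def[symmetric])

text \<open>After expansion only the cross term \<open>2 * (p * q) \<le> a * d + b * c\<close> is at
  stake. It is the inequality of arithmetic and geometric means, proved on squares to avoid
  roots.\<close>

lemma rotated_cone_convex:
  fixes p q :: real
  assumes "p\<^sup>2 \<le> a * c" "q\<^sup>2 \<le> b * d" "0 \<le> a" "0 \<le> b" "0 \<le> c" "0 \<le> d" "0 \<le> s" "0 \<le> t"
  shows "(s * p + t * q)\<^sup>2 \<le> (s * a + t * b) * (s * c + t * d)"
proof -
  have "(2 * (p * q))\<^sup>2 = 4 * (p\<^sup>2 * q\<^sup>2)" by (simp add: power_mult_distrib)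
  also have "\<dots> \<le> 4 * ((a * c) * (b * d))"
    using assms by (intro mult_left_mono mult_mono) auto
  also have "\<dots> \<le> (a * d + b * c)\<^sup>2"
    using zero_le_power2[of "a * d - b * c"] by (simp add: power2_eq_square algebra_simps)
  finally have "(2 * (p * q))\<^sup>2 \<le> (a * d + b * c)\<^sup>2" .
  moreover have "0 \<le> a * d + b * c" using assms by simp
  ultimately have "2 * (p * q) \<le> a * d + b * c" by (rule power2_le_imp_le)
  then have "s * t * (2 * (p * q)) \<le> s * t * (a * d + b * c)"
    using assms by (intro mult_left_mono) auto
  moreover have "s\<^sup>2 * p\<^sup>2 \<le> s\<^sup>2 * (a * c)" "t\<^sup>2 * q\<^sup>2 \<le> t\<^sup>2 * (b * d)"
    using assms(1,2) by (simp_all add: mult_left_mono)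
  moreover have "(s * p + t * q)\<^sup>2 = s\<^sup>2 * p\<^sup>2 + s * t * (2 * (p * q)) + t\<^sup>2 * q\<^sup>2"
    by algebra
  moreover have "(s * a + t * b) * (s * c + t * d)
      = s\<^sup>2 * (a * c) + s * t * (a * d + b * c) + t\<^sup>2 * (b * d)"
    by algebra
  ultimately show ?thesis by linarith
qed

text \<open>Joint convexity in residual and \<open>z\<close>, phrased through real upper bounds.
  Positive and negative parts are convex and nonnegative, so squaring preserves their convexity
  bounds; the rotated cones then combine the two epigraph points.\<close>

lemma split_cost_convex:
  assumes z: "0 \<le> z1" "z1 \<le> 1" "0 \<le> z2" "z2 \<le> 1" and st: "0 \<le> s" "0 \<le> t" "s + t = 1"
    and b: "split_cost r1 z1 \<le> ereal b1" "split_cost r2 z2 \<le> ereal b2"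
  shows "split_cost (s * r1 + t * r2) (s * z1 + t * z2) \<le> ereal (s * b1 + t * b2)"
proof -
  obtain \<alpha>1 \<beta>1 where 1: "0 \<le> \<alpha>1" "0 \<le> \<beta>1" "(pos_part r1)\<^sup>2 \<le> \<alpha>1 * z1"
    "(neg_part r1)\<^sup>2 \<le> \<beta>1 * (1 - z1)" "\<alpha>1 + \<beta>1 \<le> b1"
    using b(1) split_cost_le_iff[OF z(1,2)] by blast
  obtain \<alpha>2 \<beta>2 where 2: "0 \<le> \<alpha>2" "0 \<le> \<beta>2" "(pos_part r2)\<^sup>2 \<le> \<alpha>2 * z2"
    "(neg_part r2)\<^sup>2 \<le> \<beta>2 * (1 - z2)" "\<alpha>2 + \<beta>2 \<le> b2"
    using b(2) split_cost_le_iff[OF z(3,4)] by blast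
  have mono: "s * u \<le> s * max u 0" "t * u \<le> t * max u 0" "0 \<le> s * max u 0" "0 \<le> t * max u 0" for u
    using st by (auto intro!: mult_left_mono)
  have "pos_part (s * r1 + t * r2) \<le> s * pos_part r1 + t * pos_part r2"
    unfolding pos_part_def using mono[of r1] mono[of r2] by linarith
  moreover have "0 \<le> pos_part (s * r1 + t * r2)" by (simp add: pos_part_def)
  ultimately have "(pos_part (s * r1 + t * r2))\<^sup>2 \<le> (s * pos_part r1 + t * pos_part r2)\<^sup>2"
    by (intro power_mono)
  also have "\<dots> \<le> (s * \<alpha>1 + t * \<alpha>2) * (s * z1 + t * z2)"
    using 1 2 z st by (intro rotated_cone_convex) auto
  finally have P: "(pos_part (s * r1 + t * r2))\<^sup>2 \<le> (s * \<alpha>1 + t * \<alpha>2) * (s * z1 + t * z2)" .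
  have "neg_part (s * r1 + t * r2) \<le> s * neg_part r1 + t * neg_part r2"
    unfolding neg_part_def using mono[of "- r1"] mono[of "- r2"] by (simp add: max_def split: if_splits)
  moreover have "0 \<le> neg_part (s * r1 + t * r2)" by (simp add: neg_part_def)
  ultimately have "(neg_part (s * r1 + t * r2))\<^sup>2 \<le> (s * neg_part r1 + t * neg_part r2)\<^sup>2"
    by (intro power_mono)
  also have "\<dots> \<le> (s * \<beta>1 + t * \<beta>2) * (s * (1 - z1) + t * (1 - z2))"
    using 1 2 z st by (intro rotated_cone_convex) auto
  also have "s * (1 - z1) + t * (1 - z2) = 1 - (s * z1 + t * z2)"
    using st(3) by (simp add: algebra_simps)
  finally have N: "(neg_part (s * r1 + t * r2))\<^sup>2 \<le> (s * \<beta>1 + t * \<beta>2) * (1 - (s * z1 + t * z2))" .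
  have "s * z1 + t * z2 \<le> s * 1 + t * 1" using z st by (intro add_mono mult_left_mono) auto
  then have "0 \<le> s * z1 + t * z2" "s * z1 + t * z2 \<le> 1" using z st by simp_all
  moreover have "(s * \<alpha>1 + t * \<alpha>2) + (s * \<beta>1 + t * \<beta>2) \<le> s * b1 + t * b2"
    using mult_left_mono[OF 1(5) st(1)] mult_left_mono[OF 2(5) st(2)] by (simp add: algebra_simps)
  moreover have "0 \<le> s * \<alpha>1 + t * \<alpha>2" "0 \<le> s * \<beta>1 + t * \<beta>2" using 1 2 st by simp_all
  ultimately show ?thesis using P N split_cost_le_iff by blast
qed

section \<open>Lagrangian duality\<close>

text \<open>Since \<open>y\<^sup>2 = 1\<close>, expanding the squared residual yields
  \<open>outer a \<bullet> outer w\<close> as its quadratic term; thus \<open>W\<close> enters the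
  constraint only through the excess \<open>W - outer w\<close>.\<close>

lemma slack_eq:
  assumes "y \<in> {- 1, 1 :: real}"
  shows "outer a \<bullet> W - 2 * y * (a \<bullet> w) + 1 = outer a \<bullet> (W - outer w) + (1 - y * (a \<bullet> w))\<^sup>2"
proof -
  have "y\<^sup>2 = 1" using assms by auto
  then show ?thesis
    by (simp add: inner_diff_right outer_inner_outer power2_diff power_mult_distrib)
qed

text \<open>Weighting the constraints by \<gamma> and summing bounds the split costs. The squared
  residuals cancel, and the remaining gap is the inner product of the dual matrix with
  \<open>P\<close>, both positive semidefinite.\<close>

lemma saddle_le_sdp:
  fixes x :: "'n::finite \<Rightarrow> real ^ 'p::finite"
  assumes y: "\<And>i. y i \<in> {-1, 1}"
    and \<gamma>: "\<gamma> \<in> dual_feasible x" and feas: "(w, z, W) \<in> sdp_feasible x y"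
  shows "saddle_objective x y lam \<gamma> w z \<le> ereal (trace W + lam * (\<Sum>i\<in>UNIV. z $ i))"
proof -
  define r where "r i = 1 - y i * (x i \<bullet> w)" for i
  define P where "P = W - outer w"
  have \<gamma>0: "0 \<le> \<gamma> $ i" for i using \<gamma> by (simp add: dual_feasible_def)
  have "psd P" using feas by (simp add: sdp_feasible_def psd_block_iff P_def)
  have "split_cost (r i) (z $ i) \<le> ereal (outer (x i) \<bullet> P + (r i)\<^sup>2)" for i
    using feas unfolding sdp_feasible_def P_def r_def slack_eq[OF y, symmetric] by simp
  then have "(\<Sum>i\<in>UNIV. ereal (\<gamma> $ i) * split_cost (r i) (z $ i))
      \<le> (\<Sum>i\<in>UNIV. ereal (\<gamma> $ i) * ereal (outer (x i) \<bullet> P + (r i)\<^sup>2))"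
    using \<gamma>0 by (intro sum_mono ereal_mult_left_mono) auto
  also have "\<dots> = ereal ((\<Sum>i\<in>UNIV. \<gamma> $ i * (outer (x i) \<bullet> P)) + (\<Sum>i\<in>UNIV. \<gamma> $ i * (r i)\<^sup>2))"
    by (simp add: distrib_left sum.distrib)
  finally have cost: "(\<Sum>i\<in>UNIV. ereal (\<gamma> $ i) * split_cost (r i) (z $ i)) \<le> \<dots>" .
  have "0 \<le> (mat 1 - (\<Sum>i\<in>UNIV. \<gamma> $ i *\<^sub>R outer (x i))) \<bullet> P"
    using \<gamma> \<open>psd P\<close> by (intro psd_inner_nonneg) (auto simp: dual_feasible_def)
  also have "\<dots> = trace W - (norm w)\<^sup>2 - (\<Sum>i\<in>UNIV. \<gamma> $ i * (outer (x i) \<bullet> P))"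
    by (simp add: inner_diff_left inner_sum_left mat_1_inner)
      (simp add: P_def trace_sub trace_outer)
  finally have *: "0 \<le> trace W - (norm w)\<^sup>2 - (\<Sum>i\<in>UNIV. \<gamma> $ i * (outer (x i) \<bullet> P))" .
  have "saddle_objective x y lam \<gamma> w z
      \<le> ereal ((norm w)\<^sup>2 + lam * (\<Sum>i\<in>UNIV. z $ i) - (\<Sum>i\<in>UNIV. \<gamma> $ i * (r i)\<^sup>2))
        + ereal ((\<Sum>i\<in>UNIV. \<gamma> $ i * (outer (x i) \<bullet> P)) + (\<Sum>i\<in>UNIV. \<gamma> $ i * (r i)\<^sup>2))"
    unfolding saddle_objective_def r_def[symmetric] by (intro add_left_mono cost)
  also have "\<dots> \<le> ereal (trace W + lam * (\<Sum>i\<in>UNIV. z $ i))"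
    using * by simp
  finally show ?thesis .
qed

section \<open>The perturbed program and Slater's condition\<close>

text \<open>
  Right-hand sides perturbed by \<open>u\<close>. A vanishing \<open>x i\<close> turns its constraint into \<open>z $ i = 1\<close>,
  which violates Slater's condition; such constraints are made explicit and left unperturbed.
\<close>

definition perturbed_feasible ::
  "('n::finite \<Rightarrow> real ^ 'p) \<Rightarrow> ('n \<Rightarrow> real) \<Rightarrow> real ^ 'n \<Rightarrow> ((real ^ 'p) \<times> (real ^ 'n) \<times> (real ^ 'p ^ 'p)) set"
  where "perturbed_feasible x y u =
    {(w, z, W). psd (block w W) \<and> z \<in> unit_box \<and>
       (\<forall>i. if x i = 0 then z $ i = 1
            else split_cost (1 - y i * (x i \<bullet> w)) (z $ i)
              \<le> ereal (outer (x i) \<bullet> W - 2 * y i * (x i \<bullet> w) + 1 + u $ i))}"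

text \<open>For \<open>x i = 0\<close> and \<open>z $ i = 1\<close> both sides of the original
  constraint equal 1.\<close>

lemma perturbed_feasible_0:
  assumes "(w, z, W) \<in> perturbed_feasible x y 0"
  shows "(w, z, W) \<in> sdp_feasible x y"
proof -
  have "split_cost (1 - y i * (x i \<bullet> w)) (z $ i)
      \<le> ereal (outer (x i) \<bullet> W - 2 * y i * (x i \<bullet> w) + 1)" for i
    using assms by (cases "x i = 0")
      (auto simp: perturbed_feasible_def split_cost_one_one outer_inner dest: spec[of _ i])
  then show ?thesis using assms by (simp add: sdp_feasible_def perturbed_feasible_def)
qed

lemma perturbed_feasible_mono:
  assumes "(w, z, W) \<in> perturbed_feasible x y u" "\<And>i. u $ i \<le> u' $ i"
  shows "(w, z, W) \<in> perturbed_feasible x y u'"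
proof -
  have "split_cost r c \<le> ereal (b + u' $ i)" if "split_cost r c \<le> ereal (b + u $ i)" for r c b i
    using that assms(2)[of i] by (meson add_left_mono ereal_less_eq(3) order_trans)
  then show ?thesis using assms(1) unfolding perturbed_feasible_def by (auto split: if_splits)
qed

text \<open>The bounds on the split cost are affine in \<open>w\<close>, \<open>W\<close> and
  \<open>u\<close> together, while the cost is jointly convex; this is what makes the set of
  achievable pairs convex.\<close>

lemma perturbed_feasible_convex:
  assumes "(w1, z1, W1) \<in> perturbed_feasible x y u1" "(w2, z2, W2) \<in> perturbed_feasible x y u2"
    and st: "0 \<le> s" "0 \<le> t" "s + t = 1"
  shows "(s *\<^sub>R w1 + t *\<^sub>R w2, s *\<^sub>R z1 + t *\<^sub>R z2, s *\<^sub>R W1 + t *\<^sub>R W2)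
    \<in> perturbed_feasible x y (s *\<^sub>R u1 + t *\<^sub>R u2)"
proof -
  define w z W u where "w = s *\<^sub>R w1 + t *\<^sub>R w2" and "z = s *\<^sub>R z1 + t *\<^sub>R z2"
    and "W = s *\<^sub>R W1 + t *\<^sub>R W2" and "u = s *\<^sub>R u1 + t *\<^sub>R u2"
  have z1: "0 \<le> z1 $ i" "z1 $ i \<le> 1" and z2: "0 \<le> z2 $ i" "z2 $ i \<le> 1" for i
    using assms(1,2) by (auto simp: perturbed_feasible_def unit_box_def)
  have "psd (block w W)"
    using assms psd_block_convex unfolding perturbed_feasible_def w_def W_def by blast
  moreover have "z \<in> unit_box"
    using z1 z2 st by (auto simp: unit_box_def z_def intro!: convex_bound_le)
  moreover have "if x i = 0 then z $ i = 1 else split_cost (1 - y i * (x i \<bullet> w)) (z $ i)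
      \<le> ereal (outer (x i) \<bullet> W - 2 * y i * (x i \<bullet> w) + 1 + u $ i)" for i
  proof (cases "x i = 0")
    case True
    then have "z1 $ i = 1" "z2 $ i = 1"
      using assms(1,2) by (auto simp: perturbed_feasible_def dest: spec[of _ i])
    then show ?thesis using True st by (simp add: z_def)
  next
    case False
    define r1 r2 b1 b2 where "r1 = 1 - y i * (x i \<bullet> w1)" and "r2 = 1 - y i * (x i \<bullet> w2)"
      and "b1 = outer (x i) \<bullet> W1 - 2 * y i * (x i \<bullet> w1) + 1 + u1 $ i"
      and "b2 = outer (x i) \<bullet> W2 - 2 * y i * (x i \<bullet> w2) + 1 + u2 $ i"
    have "split_cost r1 (z1 $ i) \<le> ereal b1" "split_cost r2 (z2 $ i) \<le> ereal b2"
      using assms(1,2) False unfolding perturbed_feasible_def r1_def r2_def b1_def b2_def by auto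
    then have "split_cost (s * r1 + t * r2) (s * z1 $ i + t * z2 $ i) \<le> ereal (s * b1 + t * b2)"
      by (intro split_cost_convex z1 z2 st)
    moreover have "s * r1 + t * r2 = (s + t) - y i * (x i \<bullet> w)"
      by (simp add: r1_def r2_def w_def inner_add_right algebra_simps)
    moreover have "s * b1 + t * b2 = outer (x i) \<bullet> W - 2 * y i * (x i \<bullet> w) + (s + t) + u $ i"
      by (simp add: b1_def b2_def w_def W_def u_def inner_add_right algebra_simps)
    ultimately show ?thesis using False st(3) by (simp add: z_def)
  qed
  ultimately show ?thesis
    unfolding w_def[symmetric] z_def[symmetric] W_def[symmetric] u_def[symmetric]
    by (simp add: perturbed_feasible_def)
qed

lemma split_cost_one_half: "split_cost 1 (1 / 2) = ereal 2"
  by (subst split_cost_interior) (simp_all add: pos_part_def neg_part_def)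

lemma perturbed_feasible_slater:
  obtains w z W where "(w, z, W) \<in> perturbed_feasible x y (\<chi> i. - 1)"
proof -
  \<comment> \<open>At \<open>w = 0\<close> every residual is 1, so \<open>z $ i = 1 / 2\<close>
    costs 2. With \<open>W\<close> equal to \<open>T\<close> times the identity and the perturbation
    \<open>-1\<close>, the bound is \<open>T * (x i \<bullet> x i)\<close>, and \<open>T\<close> is
    large enough for all \<open>i\<close> at once. Summands with \<open>x j = 0\<close> are
    0.\<close>
  define T where "T = (\<Sum>j\<in>UNIV. 2 / (x j \<bullet> x j))"
  define z :: "real ^ 'b" where "z = (\<chi> i. if x i = 0 then 1 else 1 / 2)"
  have "2 \<le> T * (x i \<bullet> x i)" if "x i \<noteq> 0" for i
  proof -
    have "2 / (x i \<bullet> x i) \<le> T" unfolding T_def by (intro member_le_sum) auto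
    then show ?thesis using that by (simp add: pos_divide_le_eq)
  qed
  moreover have "0 \<le> T" unfolding T_def by (intro sum_nonneg) simp
  then have "psd (T *\<^sub>R mat 1 :: real ^ 'a ^ 'a)"
    by (simp add: psd_def transpose_scalar transpose_mat scaleR_matrix_vector_assoc[symmetric])
  then have "psd (block 0 (T *\<^sub>R mat 1 :: real ^ 'a ^ 'a))"
    by (simp add: psd_block_iff outer_0)
  ultimately have "(0, z, T *\<^sub>R mat 1) \<in> perturbed_feasible x y (\<chi> i. - 1)"
    by (simp add: perturbed_feasible_def unit_box_def z_def split_cost_one_half outer_inner
        scaleR_matrix_vector_assoc[symmetric])
  then show thesis by (rule that)
qed

section \<open>The multiplier from a separating hyperplane\<close>

text \<open>Extracts the sign of a coefficient from a bound along a ray: with negative slope, the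
  value at \<open>k = (\<bar>a\<bar> + 1) / (- b)\<close> would be negative.\<close>

lemma nonneg_slope:
  fixes a b :: real
  assumes "\<And>k. 0 \<le> k \<Longrightarrow> 0 \<le> a + k * b"
  shows "0 \<le> b"
proof (rule ccontr)
  assume "\<not> 0 \<le> b"
  then have "0 < - b" by simp
  then have "0 \<le> (\<bar>a\<bar> + 1) / (- b)" by (intro divide_nonneg_pos) simp_all
  then have "0 \<le> a + (\<bar>a\<bar> + 1) / (- b) * b" by (rule assms)
  also have "\<dots> = a - (\<bar>a\<bar> + 1)" using \<open>0 < - b\<close> by simp
  finally show False by simp
qed

text \<open>The normal \<open>(a, \<tau>)\<close> of the hyperplane is nonnegative because
  \<open>S\<close> is closed under increasing any coordinate. The Slater point gives
  \<open>0 < \<tau>\<close>, and the multiplier is \<open>a\<close> divided by \<tau>.\<close>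

lemma ex_Lagrange_multiplier:
  fixes x :: "'n::finite \<Rightarrow> real ^ 'p::finite"
  assumes p: "\<And>w z W. (w, z, W) \<in> sdp_feasible x y \<Longrightarrow> p \<le> trace W + lam * (\<Sum>i\<in>UNIV. z $ i)"
  obtains g :: "real ^ 'n" where "\<And>i. 0 \<le> g $ i"
    "\<And>u w z W. (w, z, W) \<in> perturbed_feasible x y u
      \<Longrightarrow> p \<le> trace W + lam * (\<Sum>i\<in>UNIV. z $ i) + g \<bullet> u"
proof -
  define f where "f z W = trace W + lam * (\<Sum>i\<in>UNIV. z $ i)" for z :: "real ^ 'n" and W :: "real ^ 'p ^ 'p"
  have f_comb: "f (s *\<^sub>R z1 + t *\<^sub>R z2) (s *\<^sub>R W1 + t *\<^sub>R W2) = s * f z1 W1 + t * f z2 W2"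
    for s t z1 z2 W1 W2
    by (simp add: f_def trace_def sum.distrib sum_distrib_left algebra_simps)
  \<comment> \<open>The strict inequality keeps the origin out: a point of \<open>S\<close> over
    \<open>u = 0\<close>, \<open>t = 0\<close> would be feasible with value below
    \<open>p\<close>.\<close>
  define S where "S = {(u, t). \<exists>w z W. (w, z, W) \<in> perturbed_feasible x y u \<and> f z W < p + t}"
  have "convex S"
  proof (rule convexI)
    fix a b :: "(real ^ 'n) \<times> real" and s t :: real
    assume ab: "a \<in> S" "b \<in> S" and st: "0 \<le> s" "0 \<le> t" "s + t = 1"
    obtain u1 t1 w1 z1 W1 where 1: "a = (u1, t1)" "(w1, z1, W1) \<in> perturbed_feasible x y u1" "f z1 W1 < p + t1"
      using ab(1) by (auto simp: S_def)
    obtain u2 t2 w2 z2 W2 where 2: "b = (u2, t2)" "(w2, z2, W2) \<in> perturbed_feasible x y u2" "f z2 W2 < p + t2"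
      using ab(2) by (auto simp: S_def)
    have "f (s *\<^sub>R z1 + t *\<^sub>R z2) (s *\<^sub>R W1 + t *\<^sub>R W2) < s * (p + t1) + t * (p + t2)"
    \<comment> \<open>Strictness is inherited from a point with positive weight, which is the second
      one if \<open>s = 0\<close>.\<close>
    proof (cases "s = 0")
      case True
      then show ?thesis using st 2 by (simp add: f_comb)
    next
      case False
      then show ?thesis using st 1(3) 2(3) unfolding f_comb
        by (intro add_less_le_mono mult_strict_left_mono mult_left_mono) auto
    qed
    also have "\<dots> = (s + t) * p + (s * t1 + t * t2)" by (simp add: algebra_simps)
    finally show "s *\<^sub>R a + t *\<^sub>R b \<in> S"
      using perturbed_feasible_convex[OF 1(2) 2(2) st] st(3) unfolding 1 2 S_def by auto
  qed
  moreover have "0 \<notin> S"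
    using p[OF perturbed_feasible_0] by (force simp: S_def f_def zero_prod_def not_less)
  ultimately obtain v where v: "v \<noteq> 0" "\<forall>s\<in>S. 0 \<le> v \<bullet> s"
    using separating_hyperplane_set_0 by blast
  obtain a \<tau> where [simp]: "v = (a, \<tau>)" by (cases v)
  have sep: "0 \<le> a \<bullet> u + \<tau> * t"
    if "(w, z, W) \<in> perturbed_feasible x y u" "f z W < p + t" for w z W u t
    using that v(2) unfolding S_def by fastforce
  obtain w0 z0 W0 where slater: "(w0, z0, W0) \<in> perturbed_feasible x y (\<chi> i. - 1)"
    using perturbed_feasible_slater .
  define t0 where "t0 = f z0 W0 - p + 1"
  have "0 \<le> \<tau>"
  proof (rule nonneg_slope)
    fix k :: real assume "0 \<le> k"
    then show "0 \<le> (a \<bullet> (\<chi> i. - 1) + \<tau> * t0) + k * \<tau>"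
      using sep[OF slater, of "t0 + k"] by (simp add: t0_def algebra_simps)
  qed
  have a: "0 \<le> a $ i" for i
  proof (rule nonneg_slope)
    fix k :: real assume "0 \<le> k"
    then have "(w0, z0, W0) \<in> perturbed_feasible x y ((\<chi> i. - 1) + k *\<^sub>R axis i 1)"
      by (intro perturbed_feasible_mono[OF slater]) (simp add: axis_def)
    from sep[OF this, of t0] show "0 \<le> (a \<bullet> (\<chi> i. - 1) + \<tau> * t0) + k * a $ i"
      by (simp add: t0_def inner_add_right inner_axis)
  qed
  \<comment> \<open>A vertical hyperplane would give a nonpositive sum of the nonnegative entries of
    \<open>a\<close> at the Slater point, hence a zero normal.\<close>
  have "\<tau> \<noteq> 0"
  proof
    assume "\<tau> = 0"
    then have "0 \<le> a \<bullet> (\<chi> i. - 1)" using sep[OF slater, of t0] by (simp add: t0_def)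
    then have "(\<Sum>i\<in>UNIV. a $ i) \<le> 0" by (simp add: inner_vec_def sum_negf)
    then have "a $ i = 0" for i
      using a sum_nonneg_eq_0_iff[of UNIV "\<lambda>i. a $ i"] sum_nonneg[of UNIV "\<lambda>i. a $ i"]
      by (simp add: order_antisym)
    then show False using v(1) \<open>\<tau> = 0\<close> by (simp add: vec_eq_iff zero_prod_def)
  qed
  with \<open>0 \<le> \<tau>\<close> have "0 < \<tau>" by simp
  show thesis
  proof
    show "0 \<le> ((1 / \<tau>) *\<^sub>R a) $ i" for i using a \<open>0 < \<tau>\<close> by simp
    fix u w z W assume feas: "(w, z, W) \<in> perturbed_feasible x y u"
    have "p \<le> f z W + ((1 / \<tau>) *\<^sub>R a) \<bullet> u"
    \<comment> \<open>The point with \<open>t = f z W - p + e\<close> lies in \<open>S\<close> for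
      each positive \<open>e\<close>; the limit removes the strictness.\<close>
    proof (rule field_le_epsilon)
      fix e :: real assume "0 < e"
      then have "0 \<le> a \<bullet> u + \<tau> * (f z W - p + e)" by (intro sep[OF feas]) simp
      then have "0 \<le> (a \<bullet> u + \<tau> * (f z W - p + e)) / \<tau>" using \<open>0 < \<tau>\<close> by simp
      then show "p \<le> f z W + ((1 / \<tau>) *\<^sub>R a) \<bullet> u + e" using \<open>0 < \<tau>\<close> by (simp add: add_divide_distrib)
    qed
    then show "p \<le> trace W + lam * (\<Sum>i\<in>UNIV. z $ i) + ((1 / \<tau>) *\<^sub>R a) \<bullet> u" by (simp add: f_def)
  qed
qed

section \<open>From the multiplier to a dual feasible point\<close>

text \<open>This is \<open>z + 1 / z \<ge> 2\<close> in division-free form, for the residual 1 that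
  belongs to a vanishing \<open>x i\<close>.\<close>

lemma split_cost_one_ge:
  assumes "0 \<le> z" "z \<le> 1" "split_cost 1 z \<le> ereal c"
  shows "2 \<le> z + c"
proof -
  obtain \<alpha> \<beta> where ab: "0 \<le> \<alpha>" "0 \<le> \<beta>" "(pos_part 1)\<^sup>2 \<le> \<alpha> * z" "\<alpha> + \<beta> \<le> c"
    using assms split_cost_le_iff by blast
  have "2\<^sup>2 \<le> 4 * (\<alpha> * z)" using ab by (simp add: pos_part_def)
  also have "\<dots> \<le> (z + \<alpha>)\<^sup>2"
    using zero_le_power2[of "z - \<alpha>"] by (simp add: power2_eq_square algebra_simps)
  finally have "2 \<le> z + \<alpha>" by (rule power2_le_imp_le) (use ab assms in simp)
  then show ?thesis using ab by simp
qed

lemma psd_dual_matrixI: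
  fixes x :: "'n::finite \<Rightarrow> real ^ 'p::finite"
  assumes "\<And>v. (\<Sum>i\<in>UNIV. \<gamma> $ i * (x i \<bullet> v)\<^sup>2) \<le> v \<bullet> v"
  shows "psd (mat 1 - (\<Sum>i\<in>UNIV. \<gamma> $ i *\<^sub>R outer (x i)))"
proof -
  have "transpose (mat 1 - (\<Sum>i\<in>UNIV. \<gamma> $ i *\<^sub>R outer (x i))) = mat 1 - (\<Sum>i\<in>UNIV. \<gamma> $ i *\<^sub>R outer (x i))"
    by (auto simp: vec_eq_iff transpose_def mat_def outer_def mult.commute)
  moreover have "v \<bullet> ((mat 1 - (\<Sum>i\<in>UNIV. \<gamma> $ i *\<^sub>R outer (x i))) *v v)
      = v \<bullet> v - (\<Sum>i\<in>UNIV. \<gamma> $ i * (x i \<bullet> v)\<^sup>2)" for v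
    by (simp add: matrix_vector_mult_diff_rdistrib matrix_vector_mult_sum
        scaleR_matrix_vector_assoc[symmetric] outer_mult_vec inner_diff_right inner_sum_right
        power2_eq_square inner_commute mult.assoc)
  ultimately show ?thesis using assms by (simp add: psd_def)
qed

text \<open>Testing the multiplier bound along the ray \<open>W = k *\<^sub>R outer v\<close> gives
  dual feasibility; testing it at \<open>W = outer w\<close>, with perturbations that make the
  constraints tight, gives the bound on the objective.\<close>

lemma ex_dual_feasible_bound:
  fixes x :: "'n::finite \<Rightarrow> real ^ 'p::finite"
  assumes y: "\<And>i. y i \<in> {-1, 1}" and lam: "lam > 0"
    and p: "\<And>w z W. (w, z, W) \<in> sdp_feasible x y \<Longrightarrow> p \<le> trace W + lam * (\<Sum>i\<in>UNIV. z $ i)"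
  obtains \<gamma> where "\<gamma> \<in> dual_feasible x"
    "\<And>w z. z \<in> unit_box \<Longrightarrow> ereal p \<le> saddle_objective x y lam \<gamma> w z"
proof -
  obtain g where g0: "\<And>i. 0 \<le> g $ i"
    and g: "\<And>u w z W. (w, z, W) \<in> perturbed_feasible x y u
      \<Longrightarrow> p \<le> trace W + lam * (\<Sum>i\<in>UNIV. z $ i) + g \<bullet> u"
    using ex_Lagrange_multiplier[of x y p lam] p by blast
  define \<gamma> where "\<gamma> = (\<chi> i. if x i = 0 then lam else g $ i)"
  have \<gamma>0: "0 \<le> \<gamma> $ i" for i using g0 lam by (simp add: \<gamma>_def)
  have "(\<Sum>i\<in>UNIV. \<gamma> $ i * (x i \<bullet> v)\<^sup>2) \<le> v \<bullet> v" for v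
  proof -
    define z :: "real ^ 'n" where "z = (\<chi> i. if x i = 0 then 1 else 1 / 2)"
    have "0 \<le> v \<bullet> v - (\<Sum>i\<in>UNIV. g $ i * (x i \<bullet> v)\<^sup>2)"
    proof (rule nonneg_slope)
      fix k :: real assume "0 \<le> k"
      \<comment> \<open>With \<open>w = 0\<close> and cost 2 where \<open>x i \<noteq> 0\<close>,
        this is the perturbation that turns the constraint into an equality.\<close>
      define u :: "real ^ 'n" where "u = (\<chi> i. 1 - k * (x i \<bullet> v)\<^sup>2)"
      have "psd (k *\<^sub>R outer v - outer 0)"
        using \<open>0 \<le> k\<close> psd_outer[of v]
        by (simp add: psd_def vec_eq_iff transpose_def outer_0
            scaleR_matrix_vector_assoc[symmetric])
      then have "(0, z, k *\<^sub>R outer v) \<in> perturbed_feasible x y u"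
        by (simp add: perturbed_feasible_def psd_block_iff unit_box_def z_def u_def
            split_cost_one_half outer_inner_outer)
      from g[OF this] show "0 \<le> (lam * (\<Sum>i\<in>UNIV. z $ i) + (\<Sum>i\<in>UNIV. g $ i) - p)
          + k * (v \<bullet> v - (\<Sum>i\<in>UNIV. g $ i * (x i \<bullet> v)\<^sup>2))"
        by (simp add: u_def inner_vec_def[of g] trace_scaleR trace_outer power2_norm_eq_inner
            sum_subtractf sum_distrib_left algebra_simps)
    qed
    moreover have "(\<Sum>i\<in>UNIV. \<gamma> $ i * (x i \<bullet> v)\<^sup>2) = (\<Sum>i\<in>UNIV. g $ i * (x i \<bullet> v)\<^sup>2)"
      by (intro sum.cong) (auto simp: \<gamma>_def)
    ultimately show ?thesis by simp
  qed
  then have "\<gamma> \<in> dual_feasible x"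
    using \<gamma>0 psd_dual_matrixI[of \<gamma> x] by (simp add: dual_feasible_def)
  moreover have "ereal p \<le> saddle_objective x y lam \<gamma> w z" if z: "z \<in> unit_box" for w z
  proof -
    define r where "r i = 1 - y i * (x i \<bullet> w)" for i
    define cost where "cost i = split_cost (r i) (z $ i)" for i
    define c where "c i = real_of_ereal (cost i)" for i
    have z01: "0 \<le> z $ i" "z $ i \<le> 1" for i using z by (auto simp: unit_box_def)
    have cost0: "0 \<le> cost i" for i unfolding cost_def by (intro split_cost_nonneg z01)
    have obj: "saddle_objective x y lam \<gamma> w z
        = ereal ((norm w)\<^sup>2 + lam * (\<Sum>i\<in>UNIV. z $ i) - (\<Sum>i\<in>UNIV. \<gamma> $ i * (r i)\<^sup>2))
          + (\<Sum>i\<in>UNIV. ereal (\<gamma> $ i) * cost i)"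
      by (simp add: saddle_objective_def r_def cost_def)
    show ?thesis
    proof (cases "\<exists>i. \<gamma> $ i \<noteq> 0 \<and> cost i = \<infinity>")
      case True
      then obtain i where "0 < \<gamma> $ i" "cost i = \<infinity>" using \<gamma>0 by (metis order_le_less)
      then have inf: "ereal (\<gamma> $ i) * cost i = \<infinity>" by simp
      have "(\<Sum>i\<in>UNIV. ereal (\<gamma> $ i) * cost i) = \<infinity>"
        unfolding sum_Pinfty by (intro conjI bexI[of _ i] inf) simp_all
      then show ?thesis by (simp add: obj)
    next
      case False
      have cost_c: "cost i = ereal (c i)" if "\<gamma> $ i \<noteq> 0" for i
        using False that cost0[of i] unfolding c_def by (cases "cost i") auto
      \<comment> \<open>An infinite cost, for which \<open>c i\<close> is the default 0, occurs only
        with multiplier 0, so both products vanish there.\<close>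
      have "ereal (\<gamma> $ i) * cost i = ereal (\<gamma> $ i * c i)" for i
        using cost_c[of i] by (cases "\<gamma> $ i = 0") (simp_all add: zero_ereal_def[symmetric])
      then have obj_eq: "saddle_objective x y lam \<gamma> w z = ereal ((norm w)\<^sup>2
          + (\<Sum>i\<in>UNIV. lam * z $ i + \<gamma> $ i * (c i - (r i)\<^sup>2)))"
        by (simp add: obj sum.distrib sum_subtractf sum_distrib_left right_diff_distrib)
      have "p \<le> (norm w)\<^sup>2 + (\<Sum>i\<in>UNIV. lam * z $ i + \<gamma> $ i * (c i - (r i)\<^sup>2))"
      proof (rule field_le_epsilon)
        fix \<delta> :: real assume "0 < \<delta>"
        \<comment> \<open>Each of the \<open>CARD('n)\<close> coordinates may raise the objective by
          \<open>lam * e\<close>, in total by \<delta>.\<close>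
        define e where "e = \<delta> / (real CARD('n) * lam)"
        have "0 < e" using \<open>0 < \<delta>\<close> lam by (simp add: e_def)
        txt \<open>
          Where the multiplier vanishes the cost may be infinite, so there \<open>z\<close> is moved into
          the interior of the box, at the price of an increase of the objective by at most \<open>\<delta>\<close>.
        \<close>
        define h where "h i = (z $ i + e / 2) / (1 + e)" for i
        have h: "0 < h i" "h i < 1" "h i \<le> z $ i + e" for i
        proof -
          show "0 < h i" "h i < 1" using z01[of i] \<open>0 < e\<close> by (simp_all add: h_def add_nonneg_pos)
          have "0 \<le> e * z $ i + e * e" using z01[of i] \<open>0 < e\<close> by simp
          then show "h i \<le> z $ i + e"
            using \<open>0 < e\<close> by (simp add: h_def pos_divide_le_eq algebra_simps)
        qed
        define z' :: "real ^ 'n" where "z' = (\<chi> i. if x i = 0 then 1 else if \<gamma> $ i = 0 then h i else z $ i)"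
        \<comment> \<open>At \<open>W = outer w\<close> the excess vanishes, so this perturbation is
          cost minus squared residual. In \<open>u'\<close> it is set to 0 where
          \<open>x i = 0\<close>, so that \<open>g\<close> has no influence there.\<close>
        define u :: "real ^ 'n" where "u = (\<chi> i. real_of_ereal (split_cost (r i) (z' $ i)) - (r i)\<^sup>2)"
        define u' :: "real ^ 'n" where "u' = (\<chi> i. if x i = 0 then 0 else u $ i)"
        have "split_cost (r i) (z' $ i) = ereal ((r i)\<^sup>2 + u $ i)" if "x i \<noteq> 0" for i
        proof (cases "\<gamma> $ i = 0")
          case True
          then show ?thesis using that h[of i] by (simp add: u_def z'_def split_cost_interior)
        next
          case False
          then show ?thesis using that cost_c[OF False] by (simp add: u_def z'_def cost_def)
        qed
        then have "if x i = 0 then z' $ i = 1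
            else split_cost (r i) (z' $ i) \<le> ereal (outer (x i) \<bullet> (outer w - outer w) + (r i)\<^sup>2 + u' $ i)" for i
          by (simp add: z'_def u'_def)
        moreover have "z' \<in> unit_box" using z01 h by (simp add: unit_box_def z'_def less_imp_le)
        ultimately have "(w, z', outer w) \<in> perturbed_feasible x y u'"
          unfolding perturbed_feasible_def slack_eq[OF y] r_def
          by (simp only: mem_Collect_eq prod.case psd_block_outer simp_thms) blast
        from g[OF this] have "p \<le> (norm w)\<^sup>2 + (\<Sum>i\<in>UNIV. lam * z' $ i + g $ i * u' $ i)"
          by (simp add: trace_outer inner_vec_def sum.distrib sum_distrib_left)
        also have "(\<Sum>i\<in>UNIV. lam * z' $ i + g $ i * u' $ i)
            \<le> (\<Sum>i\<in>UNIV. lam * z $ i + \<gamma> $ i * (c i - (r i)\<^sup>2) + lam * e)"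
        proof (rule sum_mono)
          fix i
          have le: "0 \<le> lam * e" using lam \<open>0 < e\<close> by simp
          show "lam * z' $ i + g $ i * u' $ i \<le> lam * z $ i + \<gamma> $ i * (c i - (r i)\<^sup>2) + lam * e"
          proof (cases "x i = 0")
            case True
            then have "\<gamma> $ i = lam" "r i = 1" by (simp_all add: \<gamma>_def r_def)
            then have "2 \<le> z $ i + c i"
              using cost_c[of i] lam z01[of i] by (intro split_cost_one_ge) (auto simp: cost_def)
            \<comment> \<open>In this case the claim is
              \<open>lam \<le> lam * z $ i + lam * (c i - 1) + lam * e\<close>.\<close>
            then have "lam * 2 \<le> lam * (z $ i + c i)" using lam by simp
            then show ?thesis using True \<open>\<gamma> $ i = lam\<close> \<open>r i = 1\<close> le
              by (simp add: z'_def u'_def algebra_simps)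
          next
            case False
            show ?thesis
            proof (cases "\<gamma> $ i = 0")
              case True
              then have "lam * h i \<le> lam * (z $ i + e)" "g $ i = 0"
                using h(3)[of i] lam False by (auto simp: \<gamma>_def)
              then show ?thesis using True False by (simp add: z'_def algebra_simps)
            next
              case nz: False
              then show ?thesis using False le
                by (simp add: z'_def u'_def u_def c_def cost_def \<gamma>_def)
            qed
          qed
        qed
        also have "\<dots> = (\<Sum>i\<in>UNIV. lam * z $ i + \<gamma> $ i * (c i - (r i)\<^sup>2)) + \<delta>"
          using lam by (simp add: sum.distrib e_def)
        finally show "p \<le> (norm w)\<^sup>2 + (\<Sum>i\<in>UNIV. lam * z $ i + \<gamma> $ i * (c i - (r i)\<^sup>2)) + \<delta>"
          by simp
      qed
      then show ?thesis by (simp add: obj_eq)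
    qed
  qed
  ultimately show thesis by (rule that)
qed

theorem theorem2:
  fixes x :: "'n::finite \<Rightarrow> real ^ 'p::finite" and y :: "'n \<Rightarrow> real" and lam :: real
  assumes "\<And>i. y i \<in> {-1, 1}" and "lam > 0"
  shows "(SUP \<gamma>\<in>dual_feasible x. INF (w, z)\<in>UNIV \<times> unit_box. saddle_objective x y lam \<gamma> w z)
       = (INF (w, z, W)\<in>sdp_feasible x y. ereal (trace W + lam * (\<Sum>i\<in>UNIV. z $ i)))"
    (is "?max = ?min")
proof (rule antisym)
  show "?max \<le> ?min"
  proof (intro SUP_least INF_greatest, clarify)
    fix \<gamma> w z W assume *: "\<gamma> \<in> dual_feasible x" "(w, z, W) \<in> sdp_feasible x y"
    then have "z \<in> unit_box" by (simp add: sdp_feasible_def)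
    then have "(INF (w, z)\<in>UNIV \<times> unit_box. saddle_objective x y lam \<gamma> w z)
        \<le> saddle_objective x y lam \<gamma> w z"
      by (intro INF_lower2[of "(w, z)"]) auto
    also have "\<dots> \<le> ereal (trace W + lam * (\<Sum>i\<in>UNIV. z $ i))"
      by (rule saddle_le_sdp[OF assms(1) *])
    finally show "(INF (w, z)\<in>UNIV \<times> unit_box. saddle_objective x y lam \<gamma> w z)
        \<le> ereal (trace W + lam * (\<Sum>i\<in>UNIV. z $ i))" .
  qed
  show "?min \<le> ?max"
  \<comment> \<open>Comparing with each real \<open>p\<close> strictly below the infimum handles
    every value of \<open>?min\<close>, attained or not.\<close>
  proof (rule dense_le)
    fix b assume b: "b < ?min"
    show "b \<le> ?max"
    proof (cases b)
      case (real p)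
      have "p \<le> trace W + lam * (\<Sum>i\<in>UNIV. z $ i)" if "(w, z, W) \<in> sdp_feasible x y" for w z W
      proof -
        have "ereal p < ?min" using b real by simp
        also have "?min \<le> ereal (trace W + lam * (\<Sum>i\<in>UNIV. z $ i))"
          using that by (intro INF_lower2[of "(w, z, W)"]) auto
        finally show ?thesis by simp
      qed
      then obtain \<gamma> where \<gamma>: "\<gamma> \<in> dual_feasible x"
        "\<And>w z. z \<in> unit_box \<Longrightarrow> ereal p \<le> saddle_objective x y lam \<gamma> w z"
        using ex_dual_feasible_bound[of y lam x p] assms by blast
      then show ?thesis
        unfolding real by (intro SUP_upper2[OF \<gamma>(1)] INF_greatest) auto
    qed (use b in auto)
  qed
qed

end
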